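(* Let $E=\mathbb{N}\setminus\{0,1\}$ and, for each integer $i\geq 1$, let $$E_i=\{2i\}\cup\{2^i k+1 : k\geq 1,\ k \text{ odd}\}.$$ Then the sets $E_i$, $i\ge 1$, constitute a partition of $E$ into infinite sets, each $E_i$ contains exactly one even number, and the natural density in $E$ of the set of even elements of $E$ is equal to $1/2$.
   Context: The natural density in $E$ of a subset $S\subseteq E$ (where $E$ is an infinite subset of the natural numbers) is the limit, if it exists, as $n\to\infty$ of $|\{m\in S : m\leq n\}|/|\{m\in E: m\leq n\}|$. *)

theory Defs
  imports Complex_Main "HOL-Library.Disjoint_Sets"
begin

definition has_natural_density_in :: "nat set \<Rightarrow> nat set \<Rightarrow> real \<Rightarrow> bool" where
  "has_natural_density_in S E d \<longleftrightarrow>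
     infinite E \<and> S \<subseteq> E \<and>
     (\<lambda>n. real (card {m \<in> S. m \<le> n}) / real (card {m \<in> E. m \<le> n})) \<longlonglongrightarrow> d"

definition E_all :: "nat set" where
  "E_all = UNIV - {0, 1}"

definition E_part :: "nat \<Rightarrow> nat set" where
  "E_part i = {2 * i} \<union> {2 ^ i * k + 1 | k. k \<ge> 1 \<and> odd k}"

end

theory Submission
  imports Defs "HOL-Real_Asymp.Real_Asymp"
begin

text \<open>An even m \<ge> 2 is 2i for exactly one i \<ge> 1. For an odd m \<ge> 3, m - 1 is
  positive and even, so it factors as 2^i k with k odd and i \<ge> 1, and the exponent i is
  determined by m. Hence each m \<ge> 2 has exactly one index: existence gives
  \<open>Union_E_part\<close>, uniqueness gives \<open>E_part_index_unique\<close>. For the density,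
  there are floor(n/2) even elements up to n among n - 1 elements in all, and the quotient is
  squeezed to 1/2.\<close>

lemma pow2_times_odd_exponent_unique:
  fixes i j k l :: nat
  assumes "2 ^ i * k = 2 ^ j * l" "odd k" "odd l"
  shows "i = j"
  using assms
proof (induction i arbitrary: j)
  case 0
  then show ?case by (cases j) auto
next
  case (Suc i)
  then show ?case by (cases j) auto
qed

lemma pow2_times_odd_exists:
  fixes n :: nat
  assumes "n > 0"
  shows "\<exists>i k. n = 2 ^ i * k \<and> odd k"
  using assms
proof (induction n rule: less_induct)
  case (less n)
  show ?case
  proof (cases "even n")
    case True
    then obtain m where m: "n = 2 * m" by blast
    with less.prems have "0 < m" "m < n" by auto
    with less.IH obtain i k where "m = 2 ^ i * k" "odd k" by blast
    with m have "n = 2 ^ Suc i * k \<and> odd k" by simp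
    then show ?thesis by blast
  next
    case False
    then have "n = 2 ^ 0 * n \<and> odd n" by simp
    then show ?thesis by blast
  qed
qed

text \<open>For i \<ge> 1 every number 2^i k + 1 is odd, which leaves 2i as the only even candidate.
  At i = 0 this breaks down, since k + 1 is even for odd k.\<close>

lemma even_mem_E_part_iff:
  assumes "i \<ge> 1" "even m"
  shows "m \<in> E_part i \<longleftrightarrow> m = 2 * i"
  using assms by (auto simp: E_part_def)

lemma odd_mem_E_part_iff:
  assumes "i \<ge> 1" "odd m"
  shows "m \<in> E_part i \<longleftrightarrow> (\<exists>k. odd k \<and> m = 2 ^ i * k + 1)"
  using assms odd_pos by (fastforce simp: E_part_def)

lemma E_part_index_unique:
  assumes "i \<ge> 1" "j \<ge> 1" "m \<in> E_part i" "m \<in> E_part j"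
  shows "i = j"
proof (cases "even m")
  case True
  with assms show ?thesis by (simp add: even_mem_E_part_iff)
next
  case False
  with assms obtain k l
    where "odd k" "m = 2 ^ i * k + 1" "odd l" "m = 2 ^ j * l + 1"
    by (auto simp: odd_mem_E_part_iff)
  then show ?thesis
    using pow2_times_odd_exponent_unique[of i k j l] by simp
qed

text \<open>A partition stated for the image set cannot see whether two indices give the same set;
  the indexed form, with nonempty members, rules this out.\<close>

lemma disjoint_family_E_part: "disjoint_family_on E_part {1..}"
  using E_part_index_unique by (fastforce simp: disjoint_family_on_def)

lemma infinite_E_part: "infinite (E_part i)"
proof
  assume "finite (E_part i)"
  \<comment> \<open>Writing the odd k as 2n + 1 embeds the naturals injectively into
    \<open>E_part i\<close>.\<close>
  moreover have "range (\<lambda>n::nat. 2 ^ i * (2 * n + 1) + 1) \<subseteq> E_part i"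
  proof
    fix m assume "m \<in> range (\<lambda>n::nat. 2 ^ i * (2 * n + 1) + 1)"
    then obtain n where "m = 2 ^ i * (2 * n + 1) + 1" by blast
    moreover have "2 * n + 1 \<ge> 1 \<and> odd (2 * n + 1)" by simp
    ultimately show "m \<in> E_part i" unfolding E_part_def by blast
  qed
  ultimately have "finite (range (\<lambda>n::nat. 2 ^ i * (2 * n + 1) + 1 :: nat))"
    by (rule finite_subset[rotated])
  moreover have "inj (\<lambda>n::nat. 2 ^ i * (2 * n + 1) + 1 :: nat)"
    by (rule injI) simp
  ultimately show False
    using finite_imageD infinite_UNIV_nat by blast
qed

lemma Union_E_part: "\<Union> (E_part ` {1..}) = E_all"
proof (intro equalityI subsetI)
  fix m assume "m \<in> \<Union> (E_part ` {1..})"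
  then show "m \<in> E_all" by (auto simp: E_part_def E_all_def)
next
  fix m assume "m \<in> E_all"
  then have m: "m \<ge> 2" by (auto simp: E_all_def)
  show "m \<in> \<Union> (E_part ` {1..})"
  proof (cases "even m")
    case True
    then obtain i where "m = 2 * i" by blast
    with m have "i \<ge> 1" "m \<in> E_part i" by (auto simp: E_part_def)
    then show ?thesis by auto
  next
    case False
    obtain i k where ik: "m - 1 = 2 ^ i * k" "odd k"
      using pow2_times_odd_exists[of "m - 1"] m by auto
    \<comment> \<open>Exponent 0 would make m - 1 equal to the odd k, but m is odd.\<close>
    with False m have "i \<ge> 1" by (cases i) auto
    moreover have "m = 2 ^ i * k + 1" using ik(1) m by simp
    ultimately show ?thesis
      using False ik(2) odd_mem_E_part_iff by fastforce
  qed
qed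

lemma partition_on_E_part: "partition_on E_all (E_part ` {1..})"
proof (rule partition_onI)
  show "disjnt p q" if "p \<in> E_part ` {1..}" "q \<in> E_part ` {1..}" "p \<noteq> q" for p q
    using that E_part_index_unique by (fastforce simp: disjnt_iff)
  show "{} \<notin> E_part ` {1..}"
    by (auto simp: E_part_def)
qed (rule Union_E_part)

text \<open>Truncated subtraction gives the right value 0 also at n = 0.\<close>

lemma card_E_all_upto: "card {m \<in> E_all. m \<le> n} = n - 1"
proof -
  have "{m \<in> E_all. m \<le> n} = {2..n}" by (auto simp: E_all_def)
  then show ?thesis by simp
qed

lemma card_even_E_all_upto: "card {m \<in> {m \<in> E_all. even m}. m \<le> n} = n div 2"
proof -
  have "{m \<in> {m \<in> E_all. even m}. m \<le> n} = (\<lambda>i. 2 * i) ` {1..n div 2}"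
    by (auto simp: E_all_def elim!: evenE)
  then show ?thesis by (simp add: card_image inj_on_def)
qed

lemma even_density_in_E_all:
  "has_natural_density_in {m \<in> E_all. even m} E_all (1 / 2)"
proof -
  have "infinite E_all" by (simp add: E_all_def)
  moreover have "(\<lambda>n. real (n div 2) / real (n - 1)) \<longlonglongrightarrow> 1 / 2"
  \<comment> \<open>The squeeze comes from n - 1 \<le> 2 floor(n/2) \<le> n, divided by 2(n - 1),
    which is positive once n \<ge> 2.\<close>
  proof (rule tendsto_sandwich)
    show "\<forall>\<^sub>F n in sequentially. 1 / 2 \<le> real (n div 2) / real (n - 1)"
      using eventually_ge_at_top[of 2]
    proof eventually_elim
      case (elim n)
      have "n - 1 \<le> 2 * (n div 2)" by linarith
      then have "real (n - 1) \<le> 2 * real (n div 2)" by linarith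
      with elim show ?case by (simp add: field_simps)
    qed
    show "\<forall>\<^sub>F n in sequentially. real (n div 2) / real (n - 1) \<le> (real n / 2) / (real n - 1)"
      using eventually_ge_at_top[of 2]
    proof eventually_elim
      case (elim n)
      then show ?case
        using of_nat_div_le_of_nat[of n 2, where ?'a = real]
        by (simp only: of_nat_diff of_nat_1 of_nat_numeral) (rule divide_right_mono; simp)
    qed
    show "(\<lambda>n. (real n / 2) / (real n - 1)) \<longlonglongrightarrow> 1 / 2" by real_asymp
  qed simp
  ultimately show ?thesis
    unfolding has_natural_density_in_def card_E_all_upto card_even_E_all_upto by blast
qed

theorem mainTheorem1:
  shows "partition_on E_all (E_part ` {1..}) \<and>
         disjoint_family_on E_part {1..} \<and>
         (\<forall>i\<ge>1. infinite (E_part i)) \<and>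
         (\<forall>i\<ge>1. \<exists>!m. m \<in> E_part i \<and> even m) \<and>
         has_natural_density_in {m \<in> E_all. even m} E_all (1 / 2)"
proof (intro conjI allI impI)
  show "\<exists>!m. m \<in> E_part i \<and> even m" if "i \<ge> 1" for i
    using even_mem_E_part_iff[OF that] by (intro ex1I[of _ "2 * i"]) auto
qed (rule partition_on_E_part disjoint_family_E_part infinite_E_part even_density_in_E_all)+

end
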